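(* Let $T,U\in GL(H)$, let $\{\Lambda_i\in L(H,H_i)\}_{i\in I}$ be a $(T,T)$-controlled g-Bessel sequence and $\{\Gamma_i\in L(H,H_i)\}_{i\in I}$ a $(U,U)$-controlled g-Bessel sequence. Put $$S_{T\Gamma\Lambda U}f=\sum_{i\in I}U^*\Gamma_i^*\Lambda_iTf,\qquad S_{U\Lambda\Gamma T}f=\sum_{i\in I}T^*\Lambda_i^*\Gamma_iUf\qquad(f\in H).$$ Assume that at least one of the following holds: (a) $\{\Lambda_i\}_{i\in I}$ is a $(T,T)$-controlled g-frame for $H$ with bounds $(A,B)$, and there is a number $0\le\lambda\le A$ such that $\big\|S_{T\Gamma\Lambda U}f-\sum_{i\in I}T^*\Lambda_i^*\Lambda_iTf\big\|\le\lambda\|f\|$ for all $f\in H$; (b) there is $0<\varepsilon<1$ such that $\|f-S_{T\Gamma\Lambda U}f\|\le\varepsilon\|f\|$ for all $f\in H$. Then $S_{T\Gamma\Lambda U}$ and $S_{U\Lambda\Gamma T}$ are both invertible, the family $\{S_{T\Gamma\Lambda U}^{-1}U^*\Gamma_i^*\Lambda_iT\}_{i\in I}$ is a resolution of the identity on $H$, and for all $f\in H$, $$f=\sum_{i\in I}S_{T\Gamma\Lambda U}^{-1}U^*\Gamma_i^*\Lambda_iTf=\sum_{i\in I}U^*\Gamma_i^*\Lambda_iTS_{T\Gamma\Lambda U}^{-1}f$$ and $$f=\sum_{i\in I}S_{U\Lambda\Gamma T}^{-1}T^*\Lambda_i^*\Gamma_iUf=\sum_{i\in I}T^*\Lambda_i^*\Gamma_iUS_{U\Lambda\Gamma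 T}^{-1}f .$$
   Context: $H$ is a separable Hilbert space, $I\subset\mathbb Z$, and $\{H_i\}_{i\in I}$ is a family of Hilbert spaces (closed subspaces of a common separable Hilbert space). $L(H,H_i)$ is the set of bounded linear operators $H\to H_i$; $GL(H)$ is the set of bounded linear operators on $H$ with bounded inverse. For $T\in GL(H)$, a family $\{\Lambda_i\in L(H,H_i)\}_{i\in I}$ is a $(T,T)$-controlled g-Bessel sequence with bound $B<\infty$ if $\sum_{i\in I}\|\Lambda_iTf\|^2\le B\|f\|^2$ for all $f\in H$; it is a $(T,T)$-controlled g-frame for $H$ with bounds $(A,B)$, $0<A\le B<\infty$, if it is a g-Bessel sequence (i.e. $\sum_{i\in I}\|\Lambda_if\|^2\le D\|f\|^2$ for all $f\in H$, for some $D<\infty$) and $A\|f\|^2\le\sum_{i\in I}\|\Lambda_iTf\|^2\le B\|f\|^2$ for all $f\in H$. For controlled g-Bessel sequences as in the claim, the series defining the two operators converge and define bounded operators on $H$. A family $\{\theta_j\}_{j\in J}$ of bounded operators on $H$ is a resolution of the identity if $f=\sum_{j\in J}\theta_jf$ (unconditionally convergent series) for every $f\in H$.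
   Formalization: In (a) the formal theorem requires 0 ≤ λ < A instead of 0 ≤ λ ≤ A; for λ = A the claim is false (H = ℝ, one index, T = U = Λ = id, Γ = 0, A = B = λ = 1 gives S = 0, not invertible). *)

theory Defs
  imports "HOL-Analysis.Analysis"
begin

text \<open>
  \<^term>\<open>real_inner\<close> covers only real Hilbert spaces, so the scalar field is a parameter here.
  The class below has (up to isomorphism) the two members \<open>\<real>\<close> and \<open>\<complex>\<close>; the last axiom forces
  \<open>sconj\<close> to be the identity and complex conjugation, respectively.
\<close>

class rc_field = real_normed_field +
  fixes sconj :: "'a \<Rightarrow> 'a"
  assumes sconj_add: "sconj (x + y) = sconj x + sconj y"
    and sconj_mult: "sconj (x * y) = sconj x * sconj y"
    and mult_sconj: "x * sconj x = ((norm x)\<^sup>2) *\<^sub>R 1"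

instantiation real :: rc_field
begin
definition sconj_real :: "real \<Rightarrow> real" where "sconj_real x = x"
instance by standard (auto simp: sconj_real_def power2_eq_square)
end

instantiation complex :: rc_field
begin
definition sconj_complex :: "complex \<Rightarrow> complex" where "sconj_complex = cnj"
instance by standard (auto simp: sconj_complex_def scaleR_conv_of_real complex_norm_square simp del: of_real_power)
end

text \<open>
  The norm of the type is the one induced by the inner product (axiom \<open>ip_self\<close>, which also
  gives positive definiteness), and completeness comes from the class \<open>banach\<close>.
\<close>

locale separable_hilbert_space = vector_space scale
  for scale :: "'k::rc_field \<Rightarrow> 'a::banach \<Rightarrow> 'a" +
  fixes ip :: "'a \<Rightarrow> 'a \<Rightarrow> 'k"
  assumes scale_of_real: "scale (of_real r) x = r *\<^sub>R x"
    and ip_add_left: "ip (x + y) z = ip x z + ip y z"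
    and ip_scale_left: "ip (scale c x) y = c * ip x y"
    and ip_commute: "ip y x = sconj (ip x y)"
    and ip_self: "ip x x = of_real ((norm x)\<^sup>2)"
    and separable: "separable_space (euclidean :: 'a topology)"

definition closed_subspace :: "('k::rc_field \<Rightarrow> 'b::banach \<Rightarrow> 'b) \<Rightarrow> 'b set \<Rightarrow> bool"
  where "closed_subspace s V \<longleftrightarrow> module.subspace s V \<and> closed V"

text \<open>
  \<^term>\<open>bounded_linear\<close> is boundedness together with real linearity; linearity over \<open>'k\<close> is
  required separately.
\<close>

definition bounded_op ::
  "('k::rc_field \<Rightarrow> 'a::banach \<Rightarrow> 'a) \<Rightarrow> ('k \<Rightarrow> 'b::banach \<Rightarrow> 'b) \<Rightarrow> 'b set \<Rightarrow> ('a \<Rightarrow> 'b) set"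
  where "bounded_op s1 s2 V =
    {f. Vector_Spaces.linear s1 s2 f \<and> bounded_linear f \<and> range f \<subseteq> V}"

definition GL :: "('k::rc_field \<Rightarrow> 'a::banach \<Rightarrow> 'a) \<Rightarrow> ('a \<Rightarrow> 'a) set"
  where "GL s = {T. T \<in> bounded_op s s UNIV \<and> bij T \<and> inv T \<in> bounded_op s s UNIV}"

text \<open>
  Since \<open>adj\<close> is defined pointwise, for an operator \<open>f\<close> with values in a closed subspace
  \<open>V\<close> and \<open>y \<in> V\<close>, the vector \<open>adj ip1 ip2 f y\<close> is the value at \<open>y\<close> of the adjoint of \<open>f\<close> as an
  operator into the Hilbert space \<open>V\<close>.
\<close>

definition adj :: "('a \<Rightarrow> 'a \<Rightarrow> 'k) \<Rightarrow> ('b \<Rightarrow> 'b \<Rightarrow> 'k) \<Rightarrow> ('a \<Rightarrow> 'b) \<Rightarrow> 'b \<Rightarrow> 'a"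
  where "adj ip1 ip2 f y = (THE z. \<forall>x. ip2 (f x) y = ip1 x z)"

text \<open>
  \<^term>\<open>infsum\<close> is 0 for a divergent series, hence the separate summability requirement.
\<close>

definition g_bessel_bound ::
  "'i set \<Rightarrow> ('a::banach \<Rightarrow> 'a) \<Rightarrow> ('i \<Rightarrow> 'a \<Rightarrow> 'b::banach) \<Rightarrow> real \<Rightarrow> bool"
  where "g_bessel_bound I T L B \<longleftrightarrow>
    (\<forall>f. (\<lambda>i. (norm (L i (T f)))\<^sup>2) summable_on I \<and>
         (\<Sum>\<^sub>\<infinity>i\<in>I. (norm (L i (T f)))\<^sup>2) \<le> B * (norm f)\<^sup>2)"

definition controlled_g_bessel ::
  "('k::rc_field \<Rightarrow> 'a::banach \<Rightarrow> 'a) \<Rightarrow> ('k \<Rightarrow> 'b::banach \<Rightarrow> 'b) \<Rightarrow> 'i set \<Rightarrow> ('i \<Rightarrow> 'b set)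
    \<Rightarrow> ('a \<Rightarrow> 'a) \<Rightarrow> ('i \<Rightarrow> 'a \<Rightarrow> 'b) \<Rightarrow> bool"
  where "controlled_g_bessel s1 s2 I V T L \<longleftrightarrow>
    T \<in> GL s1 \<and> (\<forall>i\<in>I. L i \<in> bounded_op s1 s2 (V i)) \<and> (\<exists>B. g_bessel_bound I T L B)"

definition controlled_g_frame ::
  "('k::rc_field \<Rightarrow> 'a::banach \<Rightarrow> 'a) \<Rightarrow> ('k \<Rightarrow> 'b::banach \<Rightarrow> 'b) \<Rightarrow> 'i set \<Rightarrow> ('i \<Rightarrow> 'b set)
    \<Rightarrow> ('a \<Rightarrow> 'a) \<Rightarrow> ('i \<Rightarrow> 'a \<Rightarrow> 'b) \<Rightarrow> real \<Rightarrow> real \<Rightarrow> bool"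
  where "controlled_g_frame s1 s2 I V T L A B \<longleftrightarrow>
    T \<in> GL s1 \<and> (\<forall>i\<in>I. L i \<in> bounded_op s1 s2 (V i)) \<and>
    0 < A \<and> A \<le> B \<and> (\<exists>D. g_bessel_bound I id L D) \<and> g_bessel_bound I T L B \<and>
    (\<forall>f. A * (norm f)\<^sup>2 \<le> (\<Sum>\<^sub>\<infinity>i\<in>I. (norm (L i (T f)))\<^sup>2))"

text \<open>
  \<open>has_sum\<close> is convergence along the net of finite subsets, i.e. unconditional convergence.
\<close>

definition resolution_of_identity ::
  "('k::rc_field \<Rightarrow> 'a::banach \<Rightarrow> 'a) \<Rightarrow> 'i set \<Rightarrow> ('i \<Rightarrow> 'a \<Rightarrow> 'a) \<Rightarrow> bool"
  where "resolution_of_identity s J \<theta> \<longleftrightarrow>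
    (\<forall>j\<in>J. \<theta> j \<in> bounded_op s s UNIV) \<and> (\<forall>f. ((\<lambda>j. \<theta> j f) has_sum f) J)"

definition cross_op ::
  "('a::banach \<Rightarrow> 'a \<Rightarrow> 'k) \<Rightarrow> ('b::banach \<Rightarrow> 'b \<Rightarrow> 'k) \<Rightarrow> 'i set
    \<Rightarrow> ('a \<Rightarrow> 'a) \<Rightarrow> ('i \<Rightarrow> 'a \<Rightarrow> 'b) \<Rightarrow> ('i \<Rightarrow> 'a \<Rightarrow> 'b) \<Rightarrow> ('a \<Rightarrow> 'a) \<Rightarrow> 'a \<Rightarrow> 'a"
  where "cross_op ip1 ip2 I T G L U f =
    (\<Sum>\<^sub>\<infinity>i\<in>I. adj ip1 ip1 U (adj ip1 ip2 (G i) (L i (T f))))"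


lemma separable_hilbert_space_inner:
  assumes "separable_space (euclidean :: 'a topology)"
  shows "separable_hilbert_space scaleR (inner :: 'a::{real_inner,banach} \<Rightarrow> 'a \<Rightarrow> real)"
  using assms
  by unfold_locales
    (auto simp: sconj_real_def inner_commute inner_add_left dot_square_norm algebra_simps)

lemma separable_space_real: "separable_space (euclidean :: real topology)"
  unfolding separable_space_def using countable_rat Rats_closure_real
  by (intro exI[of _ "\<rat>"]) auto

text \<open>
  The admissible perturbation size in the theorem has to be strictly smaller than the lower frame
  bound \<open>A\<close>: for \<open>\<lambda> = A\<close> (here \<open>A = 1\<close>, \<open>H = \<real>\<close>, \<open>\<Lambda> = id\<close>, \<open>\<Gamma> = 0\<close>) the
  operator need not be invertible.
\<close>

lemma perturbation_size_eq_lower_bound: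
  fixes I :: "int set" and L G :: "int \<Rightarrow> real \<Rightarrow> real"
  defines "I \<equiv> {0}" and "L \<equiv> \<lambda>_ x. x" and "G \<equiv> \<lambda>_ _. 0"
  defines "S \<equiv> cross_op (inner :: real \<Rightarrow> _) (inner :: real \<Rightarrow> _) I"
  shows "controlled_g_bessel scaleR scaleR I (\<lambda>_. UNIV) id G"
    and "controlled_g_frame scaleR scaleR I (\<lambda>_. UNIV) id L 1 1"
    and "norm (S id G L id f - S id L L id f) \<le> 1 * norm f"
    and "S id G L id \<notin> GL scaleR"
proof -
  have lin: "Vector_Spaces.linear scaleR scaleR h \<longleftrightarrow> linear h" for h :: "real \<Rightarrow> real"
    by (simp add: linear_def)
  have bo: "(\<lambda>x. x) \<in> bounded_op scaleR scaleR (UNIV :: real set)"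
    "(\<lambda>x::real. 0) \<in> bounded_op scaleR scaleR (UNIV :: real set)"
    by (auto simp: bounded_op_def lin bounded_linear_ident bounded_linear_zero
        bounded_linear.linear)
  have GL: "id \<in> GL (scaleR :: real \<Rightarrow> real \<Rightarrow> real)"
    using bo(1) by (simp add: GL_def id_def[symmetric] inv_id)
  show "controlled_g_bessel scaleR scaleR I (\<lambda>_. UNIV) id G"
    using GL bo(2) by (auto simp: controlled_g_bessel_def g_bessel_bound_def I_def G_def
        intro!: exI[of _ 0])
  show "controlled_g_frame scaleR scaleR I (\<lambda>_. UNIV) id L 1 1"
    using GL bo(1) by (auto simp: controlled_g_frame_def g_bessel_bound_def I_def L_def
        intro!: exI[of _ 1])
  have adj_id: "adj inner inner (\<lambda>x::real. x) y = y" for y :: real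
    unfolding adj_def by (rule the_equality) (auto dest: spec[of _ 1])
  have adj_0: "adj inner inner (\<lambda>x::real. 0::real) y = (0::real)" for y :: real
    unfolding adj_def by (rule the_equality) (auto dest: spec[of _ 1])
  have S: "S id G L id = (\<lambda>_. 0)" "S id L L id = (\<lambda>x. x)"
    by (simp_all add: fun_eq_iff S_def cross_op_def I_def L_def G_def id_def adj_id adj_0
        del: inner_real_def)
  show "norm (S id G L id f - S id L L id f) \<le> 1 * norm f"
    by (simp add: S)
  have "\<not> inj (\<lambda>_::real. 0::real)"
    by (auto simp: inj_def intro: exI[of _ 1])
  then show "S id G L id \<notin> GL scaleR"
    by (auto simp: S GL_def bij_def)
qed

end

theory Submission
  imports Defs
begin

text \<open>
  The control operators are absorbed into the families: with \<open>P i = \<Lambda> i \<circ> T\<close> and \<open>Q i = \<Gamma> i \<circ> U\<close>,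
  which are ordinary Bessel families, \<open>S\<close> is the mixed frame operator \<open>\<Sum> (Q i)\<^sup>* (P i)\<close> and \<open>S'\<close> is the
  one with the roles of \<open>P\<close> and \<open>Q\<close> exchanged (\<open>cross_op_eq_mixed_op\<close>). Such a series converges
  unconditionally, because by the Cauchy-Schwarz inequality the norm of a finite partial sum is at most
  a constant times the square root of the corresponding partial sum of \<open>(norm (P i f))\<^sup>2\<close>
  (\<open>norm_sum_mixed_le\<close>, \<open>mixed_op_has_sum\<close>), and its sum is a bounded operator.

  Both alternatives in the hypothesis are forms of coercivity,
  \<open>c * (norm f)\<^sup>2 \<le> re (ip (S f) f)\<close> with \<open>c > 0\<close>. In case (a), \<open>ip (\<Sum> (P i)\<^sup>* (P i) f) f\<close> is
  \<open>\<Sum> (norm (P i f))\<^sup>2 \<ge> A * (norm f)\<^sup>2\<close> and the perturbation costs at most \<open>lam * (norm f)\<^sup>2\<close>, so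
  \<open>c = A - lam\<close>; in case (b), \<open>c = 1 - \<epsilon>\<close>. Since \<open>S'\<close> is the adjoint of \<open>S\<close>, it has the same real
  quadratic form (\<open>re_ip_mixed_op_swap\<close>), so one application of the Lax-Milgram lemma
  (\<open>coercive_imp_GL\<close>) to each of them gives both inverses at once. The expansions follow by applying
  \<open>inv S\<close> to the series of \<open>S f\<close>, or by taking the series of \<open>S\<close> at \<open>inv S f\<close>
  (\<open>mixed_op_reconstruction\<close>).

  The adjoints, defined by a description, exist by the Riesz representation theorem, which is proved
  here over an arbitrary scalar field of the class \<open>rc_field\<close>.
\<close>

section \<open>Scalars\<close>

lemma mult_sconj_of_real:
  fixes x :: "'k::rc_field"
  shows "x * sconj x = of_real ((norm x)\<^sup>2)"
  by (simp add: mult_sconj of_real_def)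

lemma sconj_0 [simp]: "sconj (0::'k::rc_field) = 0"
  using sconj_add[of "0::'k" 0] by simp

lemma sconj_1 [simp]: "sconj (1::'k::rc_field) = 1"
  using mult_sconj_of_real[of "1::'k"] by simp

lemma norm_sconj [simp]: "norm (sconj x) = norm (x::'k::rc_field)"
proof (cases "x = 0")
  case False
  have "norm x * norm (sconj x) = norm x * norm x"
    using arg_cong[OF mult_sconj_of_real[of x], of norm]
    by (simp add: norm_mult norm_power power2_eq_square)
  with False show ?thesis by simp
qed simp

lemma sconj_sconj [simp]: "sconj (sconj x) = (x::'k::rc_field)"
proof (cases "x = 0")
  case False
  then have "sconj x \<noteq> 0" by (metis norm_eq_zero norm_sconj)
  moreover have "sconj x * sconj (sconj x) = sconj x * x"
    using mult_sconj_of_real[of x] mult_sconj_of_real[of "sconj x"] by (simp add: mult.commute)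
  ultimately show ?thesis by simp
qed simp

text \<open>The real part, obtained from norms alone, since a scalar field given only by \<open>norm\<close> and
  \<open>sconj\<close> offers no coordinates: the formula is the polarisation of \<open>(norm (1 + x))\<^sup>2\<close>.\<close>

definition re :: "'k::rc_field \<Rightarrow> real"
  where "re x = ((norm (1 + x))\<^sup>2 - 1 - (norm x)\<^sup>2) / 2"

text \<open>Expanding \<open>(1 + x) * sconj (1 + x)\<close> shows that \<open>x + sconj x\<close> is a real scalar.\<close>

lemma of_real_re: "of_real (2 * re x) = x + sconj (x::'k::rc_field)"
proof -
  have "of_real ((norm (1 + x))\<^sup>2) = (1 + x) * (1 + sconj x)"
    by (simp add: mult_sconj_of_real[symmetric] sconj_add del: of_real_power)
  also have "\<dots> = 1 + x + sconj x + of_real ((norm x)\<^sup>2)"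
    by (simp add: mult_sconj_of_real[symmetric] algebra_simps del: of_real_power)
  finally show ?thesis
    unfolding re_def by (simp add: algebra_simps)
qed

lemma re_eqI: "of_real (2 * r) = x + sconj x \<Longrightarrow> re (x::'k::rc_field) = r"
  by (metis of_real_re of_real_eq_iff mult_cancel_left zero_neq_numeral)

lemma sconj_of_real [simp]: "sconj (of_real r :: 'k::rc_field) = of_real r"
proof (cases "r = 0")
  case False
  have "of_real r * sconj (of_real r :: 'k) = of_real r * of_real r"
    using mult_sconj_of_real[of "of_real r :: 'k"] by (simp add: power2_eq_square)
  with False show ?thesis by simp
qed simp

lemma re_of_real [simp]: "re (of_real r :: 'k::rc_field) = r"
  by (rule re_eqI) simp

lemma re_add: "re (x + y) = re x + re (y::'k::rc_field)"
proof (rule re_eqI)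
  show "of_real (2 * (re x + re y)) = x + y + sconj (x + y)"
    using of_real_re[of x] of_real_re[of y] by (simp add: sconj_add algebra_simps)
qed

lemma re_of_real_mult: "re (of_real r * x) = r * re (x::'k::rc_field)"
proof (rule re_eqI)
  have "of_real (2 * (r * re x)) = of_real r * (of_real (2 * re x) :: 'k)" by simp
  also have "\<dots> = of_real r * x + sconj (of_real r * x)"
    by (simp only: of_real_re sconj_mult sconj_of_real distrib_left)
  finally show "of_real (2 * (r * re x)) = of_real r * x + sconj (of_real r * x)" .
qed

lemma re_sconj [simp]: "re (sconj x) = re (x::'k::rc_field)"
  by (rule re_eqI) (metis of_real_re add.commute sconj_sconj)

lemma re_minus: "re (- x) = - re (x::'k::rc_field)"
  using re_of_real_mult[of "-1" x] by simp

lemma re_diff: "re (x - y) = re x - re (y::'k::rc_field)"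
  using re_add[of x "- y"] by (simp add: re_minus)

lemma abs_re_le_norm: "\<bar>re x\<bar> \<le> norm (x::'k::rc_field)"
proof -
  have "2 * \<bar>re x\<bar> = norm (of_real (2 * re x) :: 'k)" by simp
  also have "\<dots> \<le> norm x + norm x"
    unfolding of_real_re by (metis norm_sconj norm_triangle_ineq)
  finally show ?thesis by simp
qed

lemma bounded_linear_re: "bounded_linear (re :: 'k::rc_field \<Rightarrow> real)"
  by (rule bounded_linear_intro[where K = 1])
    (simp_all add: re_add scaleR_conv_of_real re_of_real_mult abs_re_le_norm)

text \<open>Testing with \<open>c = sconj d\<close> gives \<open>(norm d)\<^sup>2 = 0\<close>.\<close>

lemma eq_0_if_re_mult_0:
  fixes d :: "'k::rc_field"
  assumes "\<And>c. re (c * d) = 0"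
  shows "d = 0"
  using assms[of "sconj d"] mult_sconj_of_real[of d]
  by (simp add: mult.commute del: of_real_power)

section \<open>Geometry of the inner product\<close>

context separable_hilbert_space
begin

lemma ip_add_right: "ip x (y + z) = ip x y + ip x z"
  by (metis ip_commute ip_add_left sconj_add)

lemma ip_scale_right: "ip x (scale c y) = sconj c * ip x y"
  by (metis ip_commute ip_scale_left sconj_mult)

lemma ip_scaleR_left: "ip (r *\<^sub>R x) y = of_real r * ip x y"
  by (metis scale_of_real ip_scale_left)

lemma ip_scaleR_right: "ip x (r *\<^sub>R y) = of_real r * ip x y"
  by (metis scale_of_real ip_scale_right sconj_of_real)

lemma ip_minus_left: "ip (- x) y = - ip x y"
  using ip_scaleR_left[of "-1"] by simp

lemma ip_minus_right: "ip x (- y) = - ip x y"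
  using ip_scaleR_right[of x "-1"] by simp

lemma ip_diff_left: "ip (x - y) z = ip x z - ip y z"
  using ip_add_left[of x "- y"] by (simp add: ip_minus_left)

lemma ip_diff_right: "ip x (y - z) = ip x y - ip x z"
  using ip_add_right[of x y "- z"] by (simp add: ip_minus_right)

lemma re_ip_self: "re (ip x x) = (norm x)\<^sup>2"
  unfolding ip_self by (rule re_of_real)

lemma re_ip_commute: "re (ip y x) = re (ip x y)"
  by (metis ip_commute re_sconj)

lemma norm_scale: "norm (scale c x) = norm c * norm x"
proof -
  have "of_real ((norm (scale c x))\<^sup>2) = (of_real ((norm c * norm x)\<^sup>2) :: 'k)"
    unfolding ip_self[symmetric] ip_scale_left ip_scale_right mult.assoc[symmetric]
      mult_sconj_of_real mult.commute[of "sconj c"]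
    by (simp add: ip_self power_mult_distrib)
  then show ?thesis
    by (metis of_real_eq_iff power2_eq_iff_nonneg norm_ge_zero mult_nonneg_nonneg)
qed

lemma bounded_linear_scale: "bounded_linear (scale c)"
proof (rule bounded_linear_intro[where K = "norm c"])
  show "scale c (r *\<^sub>R x) = r *\<^sub>R scale c x" for r x
    by (metis scale_of_real scale_left_commute)
qed (simp_all add: scale_right_distrib norm_scale mult.commute)

lemma norm_add_sq: "(norm (x + y))\<^sup>2 = (norm x)\<^sup>2 + 2 * re (ip x y) + (norm y)\<^sup>2"
proof -
  have "re (ip (x + y) (x + y)) = re (ip x x) + 2 * re (ip x y) + re (ip y y)"
    by (simp add: ip_add_left ip_add_right re_add re_ip_commute[of y x])
  then show ?thesis by (simp add: re_ip_self)
qed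

text \<open>The norm satisfies the triangle inequality, so squaring it gives the real part of the
  Cauchy-Schwarz inequality; the phase of \<open>ip x y\<close> is then absorbed into \<open>x\<close>.\<close>

lemma re_ip_le: "re (ip x y) \<le> norm x * norm y"
proof -
  have "(norm (x + y))\<^sup>2 \<le> (norm x + norm y)\<^sup>2"
    by (intro power_mono norm_triangle_ineq) simp
  then show ?thesis unfolding norm_add_sq by (simp add: power2_sum)
qed

lemma norm_ip_le: "norm (ip x y) \<le> norm x * norm y"
proof (cases "ip x y = 0")
  case False
  have "norm (ip x y) * norm (ip x y) = re (ip (scale (sconj (ip x y)) x) y)"
    by (simp add: ip_scale_left mult.commute[of "sconj _"] mult_sconj_of_real
        power2_eq_square flip: of_real_mult)
  also have "\<dots> \<le> norm (scale (sconj (ip x y)) x) * norm y" by (rule re_ip_le)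
  also have "\<dots> = norm (ip x y) * (norm x * norm y)" by (simp add: norm_scale)
  finally show ?thesis using False by (simp add: mult_le_cancel_left)
qed simp

lemma bounded_linear_ip_left: "bounded_linear (\<lambda>x. ip x y)"
  by (rule bounded_linear_intro[where K = "norm y"])
    (simp_all add: ip_add_left ip_scaleR_left norm_ip_le scaleR_conv_of_real)

lemma ip_eq_all_left: "(\<And>x. ip x y = ip x z) \<Longrightarrow> y = z"
proof -
  assume *: "\<And>x. ip x y = ip x z"
  have "ip (y - z) (y - z) = 0" by (simp add: ip_diff_right *)
  then show "y = z" by (simp add: ip_self)
qed

text \<open>The Riesz representation theorem, by Dirichlet's principle: the representing vector minimises
  \<open>J x = (norm x)\<^sup>2 - 2 * re (\<phi> x)\<close>. The parallelogram identity for \<open>J\<close> makes every minimising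
  sequence Cauchy, and the first variation of \<open>J\<close> at the minimum is the representation.\<close>

lemma riesz:
  assumes lin: "bounded_linear \<phi>" and scl: "\<And>c x. \<phi> (scale c x) = c * \<phi> x"
  shows "\<exists>z. \<forall>x. \<phi> x = ip x z"
proof -
  interpret bounded_linear \<phi> by fact
  obtain M where M: "\<And>x. norm (\<phi> x) \<le> norm x * M"
    using bounded by blast
  define J where "J x = (norm x)\<^sup>2 - 2 * re (\<phi> x)" for x
  have bound: "- M\<^sup>2 \<le> J x" for x
  proof -
    have "re (\<phi> x) \<le> norm x * M"
      using M[of x] abs_re_le_norm[of "\<phi> x"] by linarith
    moreover have "0 \<le> (norm x - M)\<^sup>2" by simp
    ultimately show ?thesis unfolding J_def power2_diff by linarith
  qed
  define m where "m = Inf (range J)"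
  have bdd: "bdd_below (range J)" by (rule bdd_belowI[of _ "- M\<^sup>2"]) (auto simp: bound)
  have m_le: "m \<le> J x" for x
    unfolding m_def by (rule cInf_lower[OF _ bdd]) simp
  have "\<exists>x. J x < m + 1 / real (Suc n)" for n
  proof -
    have "Inf (range J) < m + 1 / real (Suc n)" by (simp add: m_def)
    then show ?thesis using cInf_less_iff[of "range J"] bdd by auto
  qed
  then obtain X where X: "\<And>n. J (X n) < m + 1 / real (Suc n)" by metis
  have par: "(norm (x - y))\<^sup>2 = 2 * J x + 2 * J y - 4 * J ((1/2) *\<^sub>R (x + y))" for x y
  proof -
    have 1: "(norm (x - y))\<^sup>2 = (norm x)\<^sup>2 - 2 * re (ip x y) + (norm y)\<^sup>2"
      using norm_add_sq[of x "- y"] by (simp add: ip_minus_right re_minus)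
    have "\<phi> ((1/2) *\<^sub>R (x + y)) = of_real (1/2) * (\<phi> x + \<phi> y)"
      by (simp only: scaleR add scaleR_conv_of_real)
    then have 2: "re (\<phi> ((1/2) *\<^sub>R (x + y))) = (1/2) * (re (\<phi> x) + re (\<phi> y))"
      by (simp only: re_of_real_mult re_add)
    have 3: "(norm ((1/2) *\<^sub>R (x + y)))\<^sup>2 = (norm (x + y))\<^sup>2 / 4"
      by (simp add: power_divide)
    show ?thesis unfolding J_def 1 2 3 norm_add_sq by (simp add: field_simps)
  qed
  have "Cauchy X"
  proof (rule metric_CauchyI)
    fix e :: real assume "0 < e"
    then obtain N where N: "1 / real (Suc N) < e\<^sup>2 / 4"
      using nat_approx_posE[of "e\<^sup>2 / 4"] by auto
    have "dist (X k) (X n) < e" if "k \<ge> N" "n \<ge> N" for k n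
    proof -
      have "1 / real (Suc k) \<le> 1 / real (Suc N)" "1 / real (Suc n) \<le> 1 / real (Suc N)"
        using that by (simp_all add: frac_le)
      then have "(norm (X k - X n))\<^sup>2 < e\<^sup>2"
        using par[of "X k" "X n"] X[of k] X[of n] m_le[of "(1/2) *\<^sub>R (X k + X n)"] N
        by linarith
      then show ?thesis
        using \<open>0 < e\<close> by (simp add: dist_norm power_less_imp_less_base)
    qed
    then show "\<exists>N. \<forall>k\<ge>N. \<forall>n\<ge>N. dist (X k) (X n) < e" by blast
  qed
  then obtain z where z: "X \<longlonglongrightarrow> z"
    by (auto simp: Cauchy_convergent_iff convergent_def)
  have re_lim: "(\<lambda>n. re (\<phi> (X n))) \<longlonglongrightarrow> re (\<phi> z)"
    unfolding re_def by (intro tendsto_intros tendsto z) simp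
  have "J z \<le> m"
  proof (rule LIMSEQ_le)
    show "(\<lambda>n. J (X n)) \<longlonglongrightarrow> J z"
      unfolding J_def by (intro tendsto_intros z re_lim)
    show "(\<lambda>n. m + 1 / real (Suc n)) \<longlonglongrightarrow> m"
      using tendsto_add[OF tendsto_const LIMSEQ_inverse_real_of_nat, of m]
      by (simp add: inverse_eq_divide)
    show "\<exists>N. \<forall>n\<ge>N. J (X n) \<le> m + 1 / real (Suc n)"
      using X less_imp_le by blast
  qed
  then have min: "J z \<le> J y" for y using m_le[of y] by linarith
  have real_repr: "re (\<phi> x) = re (ip x z)" for x
  proof (rule ccontr)
    define b where "b = re (ip x z) - re (\<phi> x)"
    assume "re (\<phi> x) \<noteq> re (ip x z)"
    then have "b \<noteq> 0" by (simp add: b_def)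
    have var: "0 \<le> 2 * t * b + t\<^sup>2 * (norm x)\<^sup>2" for t
    proof -
      have "re (\<phi> (z + t *\<^sub>R x)) = re (\<phi> z) + t * re (\<phi> x)"
        by (simp only: add scaleR scaleR_conv_of_real re_add re_of_real_mult)
      moreover have "re (ip z (t *\<^sub>R x)) = t * re (ip x z)"
        by (simp only: ip_scaleR_right re_of_real_mult re_ip_commute[of x z])
      ultimately show ?thesis
        using min[of "z + t *\<^sub>R x"] unfolding J_def norm_add_sq b_def
        by (simp add: power_mult_distrib algebra_simps)
    qed
    \<comment> \<open>the step \<open>t\<close> is chosen so that the linear term outweighs the quadratic one\<close>
    define q where "q = (norm x)\<^sup>2 + 1"
    have "q > 0" unfolding q_def by (smt (verit) zero_le_power2)
    have "0 \<le> 2 * (- b / q) * b + (- b / q)\<^sup>2 * (norm x)\<^sup>2" by (rule var)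
    also have "\<dots> \<le> 2 * (- b / q) * b + (- b / q)\<^sup>2 * q"
      by (intro add_left_mono mult_left_mono) (simp_all add: q_def)
    also have "\<dots> = - (b\<^sup>2 / q)"
      using \<open>q > 0\<close> by (simp add: field_simps power2_eq_square)
    finally show False using \<open>q > 0\<close> \<open>b \<noteq> 0\<close> by (simp add: divide_le_0_iff)
  qed
  have "\<phi> x - ip x z = 0" for x
  proof (rule eq_0_if_re_mult_0)
    fix c
    show "re (c * (\<phi> x - ip x z)) = 0"
      using real_repr[of "scale c x"]
      by (simp add: scl ip_scale_left right_diff_distrib re_diff)
  qed
  then show ?thesis by auto
qed

end

section \<open>Bounded operators\<close>

lemma bounded_op_add: "h \<in> bounded_op s1 s2 W \<Longrightarrow> h (x + y) = h x + h y"
  by (simp add: bounded_op_def Vector_Spaces.linear_iff)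

lemma bounded_op_scale: "h \<in> bounded_op s1 s2 W \<Longrightarrow> h (s1 c x) = s2 c (h x)"
  by (simp add: bounded_op_def Vector_Spaces.linear_iff)

lemma bounded_op_bounded_linear: "h \<in> bounded_op s1 s2 W \<Longrightarrow> bounded_linear h"
  by (simp add: bounded_op_def)

lemma bounded_op_comp:
  assumes "g \<in> bounded_op s2 s3 W" "h \<in> bounded_op s1 s2 W'"
  shows "g \<circ> h \<in> bounded_op s1 s3 UNIV"
  using assms Vector_Spaces.linear_compose[of s1 s2 h s3 g]
    bounded_linear_compose[of g h]
  by (simp add: bounded_op_def o_def)

lemma bounded_opI:
  assumes "vector_space s1" "vector_space s2" "\<And>x y. h (x + y) = h x + h y"
    "\<And>c x. h (s1 c x) = s2 c (h x)" "bounded_linear h"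
  shows "h \<in> bounded_op s1 s2 UNIV"
  using assms by (simp add: bounded_op_def Vector_Spaces.linear_iff)

lemma GL_imp_bounded_op: "h \<in> GL s \<Longrightarrow> h \<in> bounded_op s s UNIV"
  by (simp add: GL_def)

text \<open>The Lax-Milgram lemma. For small \<open>t > 0\<close> the map \<open>x \<mapsto> x - t (S x - g)\<close> is a contraction, and
  its fixed point solves \<open>S x = g\<close>. Here \<open>t = c / M\<^sup>2\<close>, which makes the squared contraction factor
  \<open>1 - 2 t c + t\<^sup>2 M\<^sup>2\<close> equal to \<open>1 - c\<^sup>2 / M\<^sup>2\<close>.\<close>

lemma (in separable_hilbert_space) coercive_imp_GL:
  assumes S: "S \<in> bounded_op scale scale UNIV" and c: "c > 0"
    and coercive: "\<And>f. c * (norm f)\<^sup>2 \<le> re (ip (S f) f)"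
  shows "S \<in> GL scale"
proof -
  interpret S: bounded_linear S using S by (rule bounded_op_bounded_linear)
  have below: "c * norm f \<le> norm (S f)" for f
  proof (cases "f = 0")
    case False
    have "(c * norm f) * norm f \<le> norm (S f) * norm f"
      using coercive[of f] re_ip_le[of "S f" f] by (simp add: power2_eq_square)
    with False show ?thesis by simp
  qed simp
  have "inj S"
  proof (rule injI)
    fix x y assume "S x = S y"
    then have "c * norm (x - y) \<le> 0" using below[of "x - y"] by (simp add: S.diff)
    with c show "x = y" by (simp add: mult_le_0_iff)
  qed
  moreover have "surj S"
  proof (rule surjI)
    fix g
    obtain K where K: "K > 0" "\<And>x. norm (S x) \<le> norm x * K"
      using S.pos_bounded by blast
    define M where "M = K + c"
    define t where "t = c / M\<^sup>2"
    define q where "q = sqrt (1 - c\<^sup>2 / M\<^sup>2)"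
    have M: "M > 0" "c < M" and t: "t > 0" using K c by (simp_all add: M_def t_def)
    have SM: "norm (S x) \<le> M * norm x" for x
      using order_trans[OF K(2)[of x], of "norm x * M"] c
      by (simp add: M_def mult.commute[of _ "norm x"] mult_left_mono)
    have frac: "0 < c\<^sup>2 / M\<^sup>2" "c\<^sup>2 / M\<^sup>2 < 1"
      using M c by (simp_all add: power_strict_mono)
    have q: "0 \<le> q" "q < 1" "q\<^sup>2 = 1 - c\<^sup>2 / M\<^sup>2"
      using frac by (simp_all add: q_def)
    have contr: "norm (x - t *\<^sub>R S x) \<le> q * norm x" for x
    proof (rule power2_le_imp_le)
      have "(norm (x - t *\<^sub>R S x))\<^sup>2 = (norm x)\<^sup>2 - 2 * t * re (ip (S x) x) + t\<^sup>2 * (norm (S x))\<^sup>2"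
        using norm_add_sq[of x "- (t *\<^sub>R S x)"]
        by (simp add: ip_minus_right re_minus ip_scaleR_right re_of_real_mult
            re_ip_commute[of x "S x"] power_mult_distrib)
      also have "\<dots> \<le> (norm x)\<^sup>2 - 2 * t * (c * (norm x)\<^sup>2) + t\<^sup>2 * (M * norm x)\<^sup>2"
        using t by (intro add_mono diff_mono mult_left_mono power_mono coercive SM) auto
      also have "\<dots> = (1 - 2 * t * c + t\<^sup>2 * M\<^sup>2) * (norm x)\<^sup>2"
        by (simp add: algebra_simps power_mult_distrib)
      also have "1 - 2 * t * c + t\<^sup>2 * M\<^sup>2 = q\<^sup>2"
        unfolding q(3) t_def using M by (simp add: field_simps power2_eq_square)
      finally show "(norm (x - t *\<^sub>R S x))\<^sup>2 \<le> (q * norm x)\<^sup>2"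
        by (simp add: power_mult_distrib)
    qed (use q in simp)
    have "\<exists>!x. x - t *\<^sub>R (S x - g) = x"
    proof (rule banach_fix_type[OF q(1,2)], intro allI)
      fix x y
      have "x - t *\<^sub>R (S x - g) - (y - t *\<^sub>R (S y - g)) = (x - y) - t *\<^sub>R S (x - y)"
        by (simp add: S.diff algebra_simps)
      then show "dist (x - t *\<^sub>R (S x - g)) (y - t *\<^sub>R (S y - g)) \<le> q * dist x y"
        unfolding dist_norm by (simp only: contr)
    qed
    then obtain x where "x - t *\<^sub>R (S x - g) = x" by blast
    then have "S x = g" using t by simp
    then show "S (inv S g) = g" by (metis f_inv_into_f rangeI)
  qed
  ultimately have bij: "bij S" by (simp add: bij_def)
  have inv: "S (inv S g) = g" "inv S (S g) = g" for g
    using bij by (simp_all add: bij_is_surj surj_f_inv_f bij_is_inj)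
  have add: "inv S (x + y) = inv S x + inv S y" for x y
    by (metis inv S.add)
  have scl: "inv S (scale d x) = scale d (inv S x)" for d x
    by (metis inv bounded_op_scale[OF S])
  have "bounded_linear (inv S)"
  proof (rule bounded_linear_intro[where K = "1 / c"])
    show "inv S (r *\<^sub>R x) = r *\<^sub>R inv S x" for r x using scl scale_of_real by metis
    show "norm (inv S x) \<le> norm x * (1 / c)" for x
      using below[of "inv S x"] c by (simp add: inv field_simps)
  qed (rule add)
  then have "inv S \<in> bounded_op scale scale UNIV"
    by (intro bounded_opI add scl) (rule vector_space_axioms)+
  with S bij show ?thesis by (simp add: GL_def)
qed

section \<open>Adjoints\<close>

locale hilbert_pair =
  H: separable_hilbert_space sH ipH + K: separable_hilbert_space sK ipK
  for sH :: "'k::rc_field \<Rightarrow> 'h::banach \<Rightarrow> 'h" and ipH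
    and sK :: "'k \<Rightarrow> 'g::banach \<Rightarrow> 'g" and ipK
begin

lemma ip_adj:
  assumes "h \<in> bounded_op sH sK W"
  shows "ipH x (adj ipH ipK h y) = ipK (h x) y"
proof -
  have "bounded_linear (\<lambda>x. ipK (h x) y)"
    using bounded_linear_compose[OF K.bounded_linear_ip_left bounded_op_bounded_linear[OF assms]] .
  moreover have "ipK (h (sH c x)) y = c * ipK (h x) y" for c x
    by (simp add: bounded_op_scale[OF assms] K.ip_scale_left)
  ultimately obtain z where z: "\<forall>x. ipK (h x) y = ipH x z"
    using H.riesz by blast
  then have "adj ipH ipK h y = z"
    unfolding adj_def by (intro the_equality H.ip_eq_all_left) simp_all
  with z show ?thesis by simp
qed

lemma adj_ip:
  assumes "h \<in> bounded_op sH sK W"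
  shows "ipH (adj ipH ipK h y) x = ipK y (h x)"
  by (metis H.ip_commute K.ip_commute ip_adj[OF assms])

lemma adj_bounded_op:
  assumes "h \<in> bounded_op sH sK W"
  shows "adj ipH ipK h \<in> bounded_op sK sH UNIV"
proof -
  let ?a = "adj ipH ipK h"
  have add: "?a (x + y) = ?a x + ?a y" for x y
    by (rule H.ip_eq_all_left) (simp add: ip_adj[OF assms] H.ip_add_right K.ip_add_right)
  have scl: "?a (sK c x) = sH c (?a x)" for c x
    by (rule H.ip_eq_all_left) (simp add: ip_adj[OF assms] H.ip_scale_right K.ip_scale_right)
  obtain M where M: "M > 0" "\<And>x. norm (h x) \<le> norm x * M"
    using bounded_linear.pos_bounded[OF bounded_op_bounded_linear[OF assms]] by blast
  have "bounded_linear ?a"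
  proof (rule bounded_linear_intro[where K = M])
    show "?a (r *\<^sub>R x) = r *\<^sub>R ?a x" for r x
      using scl by (metis H.scale_of_real K.scale_of_real)
    show "norm (?a y) \<le> norm y * M" for y
    proof (cases "?a y = 0")
      case False
      have "(norm (?a y))\<^sup>2 = re (ipK (h (?a y)) y)"
        by (simp add: H.re_ip_self flip: ip_adj[OF assms])
      also have "\<dots> \<le> norm (h (?a y)) * norm y" by (rule K.re_ip_le)
      also have "\<dots> \<le> norm (?a y) * M * norm y" by (intro mult_right_mono M) simp
      finally have "norm (?a y) * norm (?a y) \<le> norm (?a y) * (norm y * M)"
        by (simp add: power2_eq_square mult_ac)
      with False show ?thesis by (simp add: mult_le_cancel_left)
    qed (use M in simp)
  qed (rule add)
  then show ?thesis
    by (intro bounded_opI add scl H.vector_space_axioms K.vector_space_axioms)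
qed

lemma adj_comp:
  assumes "U \<in> bounded_op sH sH W" "h \<in> bounded_op sH sK W'"
  shows "adj ipH ipH U (adj ipH ipK h y) = adj ipH ipK (h \<circ> U) y"
proof -
  interpret HH: hilbert_pair sH ipH sH ipH ..
  show ?thesis
    by (rule H.ip_eq_all_left)
      (simp add: HH.ip_adj[OF assms(1)] ip_adj[OF assms(2)] ip_adj[OF bounded_op_comp[OF assms(2,1)]])
qed

end

section \<open>Mixed frame operators of two Bessel families\<close>

text \<open>A Cauchy criterion: the squared norms of the partial sums over finite sets disjoint from a
  large one are dominated by a tail of the convergent series of \<open>g\<close>.\<close>

lemma summable_on_if_norm_sum_sq_le:
  fixes f :: "'i \<Rightarrow> 'b::banach" and g :: "'i \<Rightarrow> real"
  assumes g: "g summable_on A" "\<And>i. i \<in> A \<Longrightarrow> 0 \<le> g i"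
    and C: "C > 0" "\<And>F. finite F \<Longrightarrow> F \<subseteq> A \<Longrightarrow> (norm (sum f F))\<^sup>2 \<le> C * sum g F"
  shows "f summable_on A"
proof -
  let ?L = "infsum g A"
  have "\<exists>P. eventually P (finite_subsets_at_top A) \<and>
              (\<forall>F F'. P F \<and> P F' \<longrightarrow> dist (sum f F) (sum f F') < e)" if "e > 0" for e
  proof -
    define d where "d = (e / 2)\<^sup>2 / C"
    have "d > 0" using that C by (simp add: d_def)
    then obtain F0 where F0: "finite F0" "F0 \<subseteq> A" "dist (sum g F0) ?L \<le> d / 2"
      using has_sum_finite_approximation[OF has_sum_infsum[OF g(1)], of "d / 2"] by auto
    define P where "P F \<longleftrightarrow> finite F \<and> F \<subseteq> A \<and> F0 \<subseteq> F" for F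
    have ev: "eventually P (finite_subsets_at_top A)"
      unfolding eventually_finite_subsets_at_top P_def using F0 by blast
    have close: "dist (sum f F) (sum f F0) < e / 2" if "P F" for F
    proof -
      have F: "finite F" "F \<subseteq> A" "F0 \<subseteq> F" using that by (auto simp: P_def)
      have "sum g F \<le> ?L" using F g by (intro finite_sum_le_infsum) auto
      then have "sum g (F - F0) < d"
        using F0(3) \<open>d > 0\<close> F unfolding sum_diff[OF F(1,3)] dist_real_def by linarith
      then have "(norm (sum f (F - F0)))\<^sup>2 < C * d"
        using C(2)[of "F - F0"] F C(1)
        by (smt (verit, best) Diff_subset finite_Diff mult_strict_left_mono subset_trans)
      also have "C * d = (e / 2)\<^sup>2" using C(1) by (simp add: d_def)
      finally have "norm (sum f (F - F0)) < e / 2"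
        using \<open>e > 0\<close> by (rule power_less_imp_less_base[OF _ less_imp_le[OF half_gt_zero]])
      then show ?thesis using F F0 by (simp add: dist_norm sum_diff)
    qed
    have "dist (sum f F) (sum f F') < e" if "P F" "P F'" for F F'
      using close[OF that(1)] close[OF that(2)] dist_triangle2[of "sum f F" "sum f F'" "sum f F0"]
      by linarith
    with ev show ?thesis by blast
  qed
  then have "cauchy_filter (filtermap (sum f) (finite_subsets_at_top A))"
    by (simp add: cauchy_filter_metric_filtermap)
  moreover have "complete (UNIV :: 'b set)"
    by (meson Cauchy_convergent UNIV_I complete_def convergent_def)
  ultimately obtain L' where "(sum f \<longlongrightarrow> L') (finite_subsets_at_top A)"
    using complete_uniform[where S = UNIV] by (force simp add: filterlim_def)
  then show ?thesis using summable_on_def has_sum_def by blast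
qed

context hilbert_pair
begin

definition bessel_family :: "'i set \<Rightarrow> ('i \<Rightarrow> 'h \<Rightarrow> 'g) \<Rightarrow> bool"
  where "bessel_family I P \<longleftrightarrow>
    (\<forall>i\<in>I. P i \<in> bounded_op sH sK UNIV) \<and> (\<exists>B. g_bessel_bound I id P B)"

definition mixed_op :: "'i set \<Rightarrow> ('i \<Rightarrow> 'h \<Rightarrow> 'g) \<Rightarrow> ('i \<Rightarrow> 'h \<Rightarrow> 'g) \<Rightarrow> 'h \<Rightarrow> 'h"
  where "mixed_op I P Q f = (\<Sum>\<^sub>\<infinity>i\<in>I. adj ipH ipK (Q i) (P i f))"

lemma bessel_family_bounded_op: "bessel_family I P \<Longrightarrow> i \<in> I \<Longrightarrow> P i \<in> bounded_op sH sK UNIV"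
  by (simp add: bessel_family_def)

lemma bessel_family_summable: "bessel_family I P \<Longrightarrow> (\<lambda>i. (norm (P i f))\<^sup>2) summable_on I"
  by (auto simp: bessel_family_def g_bessel_bound_def)

lemma bessel_family_bound:
  assumes "bessel_family I P"
  obtains B where "B > 0"
    and "\<And>F f. finite F \<Longrightarrow> F \<subseteq> I \<Longrightarrow> (\<Sum>i\<in>F. (norm (P i f))\<^sup>2) \<le> B * (norm f)\<^sup>2"
proof -
  obtain B where B: "\<And>f. (\<Sum>\<^sub>\<infinity>i\<in>I. (norm (P i f))\<^sup>2) \<le> B * (norm f)\<^sup>2"
    using assms by (auto simp: bessel_family_def g_bessel_bound_def)
  show ?thesis
  proof (rule that[of "\<bar>B\<bar> + 1"])
    fix F f assume F: "finite F" "F \<subseteq> I"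
    have "(\<Sum>i\<in>F. (norm (P i f))\<^sup>2) \<le> (\<Sum>\<^sub>\<infinity>i\<in>I. (norm (P i f))\<^sup>2)"
      using F bessel_family_summable[OF assms] by (intro finite_sum_le_infsum) auto
    also have "\<dots> \<le> B * (norm f)\<^sup>2" by (rule B)
    also have "\<dots> \<le> (\<bar>B\<bar> + 1) * (norm f)\<^sup>2" by (intro mult_right_mono) auto
    finally show "(\<Sum>i\<in>F. (norm (P i f))\<^sup>2) \<le> (\<bar>B\<bar> + 1) * (norm f)\<^sup>2" .
  qed simp
qed

text \<open>Pair the partial sum \<open>v\<close> with itself, move the adjoints to the other side and apply the
  Cauchy-Schwarz inequality for finite sums; the Bessel bound of \<open>Q\<close> at \<open>v\<close> then cancels one
  factor \<open>norm v\<close>.\<close>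

lemma norm_sum_mixed_le:
  assumes Q: "bessel_family I Q" and F: "F \<subseteq> I"
    and C: "C > 0" "\<And>f. (\<Sum>i\<in>F. (norm (Q i f))\<^sup>2) \<le> C * (norm f)\<^sup>2"
  shows "(norm (\<Sum>i\<in>F. adj ipH ipK (Q i) (P i f)))\<^sup>2 \<le> C * (\<Sum>i\<in>F. (norm (P i f))\<^sup>2)"
proof -
  define v where "v = (\<Sum>i\<in>F. adj ipH ipK (Q i) (P i f))"
  define p where "p = (\<Sum>i\<in>F. (norm (P i f))\<^sup>2)"
  have p: "p \<ge> 0" by (simp add: p_def sum_nonneg)
  have "(norm v)\<^sup>2 = norm (ipH v v)" by (simp add: H.ip_self norm_power)
  also have "ipH v v = (\<Sum>i\<in>F. ipK (P i f) (Q i v))"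
    unfolding v_def bounded_linear.linear[OF H.bounded_linear_ip_left, THEN linear_sum]
    using F by (intro sum.cong refl adj_ip[OF bessel_family_bounded_op[OF Q]]) auto
  also have "norm \<dots> \<le> (\<Sum>i\<in>F. \<bar>norm (P i f)\<bar> * \<bar>norm (Q i v)\<bar>)"
    by (rule sum_norm_le) (simp add: K.norm_ip_le)
  also have "\<dots> \<le> L2_set (\<lambda>i. norm (P i f)) F * L2_set (\<lambda>i. norm (Q i v)) F"
    by (rule L2_set_mult_ineq)
  also have "\<dots> \<le> sqrt p * (sqrt C * norm v)"
  proof (intro mult_mono)
    have "L2_set (\<lambda>i. norm (Q i v)) F \<le> sqrt (C * (norm v)\<^sup>2)"
      unfolding L2_set_def by (intro real_sqrt_le_mono C)
    then show "L2_set (\<lambda>i. norm (Q i v)) F \<le> sqrt C * norm v"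
      by (simp add: real_sqrt_mult)
  qed (simp_all add: L2_set_def p_def sum_nonneg)
  finally have *: "norm v * norm v \<le> (sqrt p * sqrt C) * norm v"
    by (simp add: power2_eq_square mult_ac)
  have "norm v \<le> sqrt p * sqrt C"
  proof (cases "v = 0")
    case False
    then show ?thesis using * by simp
  qed (use p C in simp)
  then have "(norm v)\<^sup>2 \<le> (sqrt p * sqrt C)\<^sup>2" by (intro power_mono) auto
  then show "(norm (\<Sum>i\<in>F. adj ipH ipK (Q i) (P i f)))\<^sup>2 \<le> C * (\<Sum>i\<in>F. (norm (P i f))\<^sup>2)"
    using p C by (simp add: power_mult_distrib v_def p_def mult.commute)
qed

lemma mixed_op_has_sum:
  assumes P: "bessel_family I P" and Q: "bessel_family I Q"
  shows "((\<lambda>i. adj ipH ipK (Q i) (P i f)) has_sum mixed_op I P Q f) I"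
proof -
  obtain C where "C > 0"
    "\<And>F f. finite F \<Longrightarrow> F \<subseteq> I \<Longrightarrow> (\<Sum>i\<in>F. (norm (Q i f))\<^sup>2) \<le> C * (norm f)\<^sup>2"
    using bessel_family_bound[OF Q] by blast
  then have "(\<lambda>i. adj ipH ipK (Q i) (P i f)) summable_on I"
    by (intro summable_on_if_norm_sum_sq_le[OF bessel_family_summable[OF P, of f]]
        norm_sum_mixed_le[OF Q]) auto
  then show ?thesis unfolding mixed_op_def by (rule has_sum_infsum)
qed

lemma mixed_op_bounded_op:
  assumes P: "bessel_family I P" and Q: "bessel_family I Q"
  shows "mixed_op I P Q \<in> bounded_op sH sH UNIV"
proof -
  let ?S = "mixed_op I P Q"
  note sums = mixed_op_has_sum[OF P Q]
  note Pop = bessel_family_bounded_op[OF P]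
  note Qop = bessel_family_bounded_op[OF Q, THEN adj_bounded_op]
  have add: "?S (x + y) = ?S x + ?S y" for x y
  proof (rule has_sum_unique[OF sums])
    show "((\<lambda>i. adj ipH ipK (Q i) (P i (x + y))) has_sum ?S x + ?S y) I"
      by (rule has_sum_cong[THEN iffD1, OF _ has_sum_add[OF sums[of x] sums[of y]]])
        (simp add: bounded_op_add[OF Pop] bounded_op_add[OF Qop])
  qed
  have scl: "?S (sH c x) = sH c (?S x)" for c x
  proof (rule has_sum_unique[OF sums])
    show "((\<lambda>i. adj ipH ipK (Q i) (P i (sH c x))) has_sum sH c (?S x)) I"
      by (rule has_sum_cong[THEN iffD1, OF _
            has_sum_bounded_linear[OF H.bounded_linear_scale sums[of x]]])
        (simp add: bounded_op_scale[OF Pop] bounded_op_scale[OF Qop])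
  qed
  obtain B where B: "B > 0"
    "\<And>F f. finite F \<Longrightarrow> F \<subseteq> I \<Longrightarrow> (\<Sum>i\<in>F. (norm (P i f))\<^sup>2) \<le> B * (norm f)\<^sup>2"
    using bessel_family_bound[OF P] by blast
  obtain C where C: "C > 0"
    "\<And>F f. finite F \<Longrightarrow> F \<subseteq> I \<Longrightarrow> (\<Sum>i\<in>F. (norm (Q i f))\<^sup>2) \<le> C * (norm f)\<^sup>2"
    using bessel_family_bound[OF Q] by blast
  have bound: "norm (?S f) \<le> norm f * sqrt (C * B)" for f
  proof (rule Lim_norm_ubound[OF _ sums[of f, unfolded has_sum_def]])
    have "norm (\<Sum>i\<in>F. adj ipH ipK (Q i) (P i f)) \<le> norm f * sqrt (C * B)"
      if F: "finite F" "F \<subseteq> I" for F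
    proof (rule power2_le_imp_le)
      have "(norm (\<Sum>i\<in>F. adj ipH ipK (Q i) (P i f)))\<^sup>2 \<le> C * (\<Sum>i\<in>F. (norm (P i f))\<^sup>2)"
        by (rule norm_sum_mixed_le[OF Q F(2) C(1) C(2)[OF F]])
      also have "\<dots> \<le> C * (B * (norm f)\<^sup>2)"
        using C(1) by (intro mult_left_mono B(2) F) simp
      finally show "(norm (\<Sum>i\<in>F. adj ipH ipK (Q i) (P i f)))\<^sup>2 \<le> (norm f * sqrt (C * B))\<^sup>2"
        using B C by (simp add: power_mult_distrib mult_ac)
    qed (use B C in simp)
    then show "\<forall>\<^sub>F F in finite_subsets_at_top I.
        norm (\<Sum>i\<in>F. adj ipH ipK (Q i) (P i f)) \<le> norm f * sqrt (C * B)"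
      by (intro eventually_finite_subsets_at_top_weakI)
  qed simp
  have "bounded_linear ?S"
  proof (rule bounded_linear_intro)
    show "?S (r *\<^sub>R x) = r *\<^sub>R ?S x" for r x using scl by (metis H.scale_of_real)
  qed (rule add bound)+
  then show ?thesis by (intro bounded_opI add scl H.vector_space_axioms)
qed

lemma ip_mixed_op_has_sum:
  assumes P: "bessel_family I P" and Q: "bessel_family I Q"
  shows "((\<lambda>i. ipK (P i f) (Q i g)) has_sum ipH (mixed_op I P Q f) g) I"
  by (rule has_sum_cong[THEN iffD1, OF _
        has_sum_bounded_linear[OF H.bounded_linear_ip_left mixed_op_has_sum[OF P Q]]])
    (simp add: adj_ip[OF bessel_family_bounded_op[OF Q]])

text \<open>Exchanging the two families passes to the adjoint, which leaves the real part of the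
  quadratic form unchanged.\<close>

lemma re_ip_mixed_op_swap:
  assumes P: "bessel_family I P" and Q: "bessel_family I Q"
  shows "re (ipH (mixed_op I Q P f) f) = re (ipH (mixed_op I P Q f) f)"
proof (rule has_sum_unique)
  show "((\<lambda>i. re (ipK (P i f) (Q i f))) has_sum re (ipH (mixed_op I P Q f) f)) I"
    by (rule has_sum_bounded_linear[OF bounded_linear_re ip_mixed_op_has_sum[OF P Q]])
  show "((\<lambda>i. re (ipK (P i f) (Q i f))) has_sum re (ipH (mixed_op I Q P f) f)) I"
    using has_sum_bounded_linear[OF bounded_linear_re ip_mixed_op_has_sum[OF Q P, of f f]]
    by (simp add: K.re_ip_commute[of "Q _ f" "P _ f"])
qed

lemma re_ip_frame_op:
  assumes P: "bessel_family I P"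
  shows "re (ipH (mixed_op I P P f) f) = (\<Sum>\<^sub>\<infinity>i\<in>I. (norm (P i f))\<^sup>2)"
  using has_sum_bounded_linear[OF bounded_linear_re ip_mixed_op_has_sum[OF P P, of f f]]
  by (simp add: K.re_ip_self infsumI)

text \<open>An invertible mixed operator may be inverted inside or outside its unconditionally convergent
  series, which gives both reconstruction formulas.\<close>

lemma mixed_op_reconstruction:
  assumes P: "bessel_family I P" and Q: "bessel_family I Q" and GL: "mixed_op I P Q \<in> GL sH"
  shows "((\<lambda>i. inv (mixed_op I P Q) (adj ipH ipK (Q i) (P i f))) has_sum f) I"
    and "((\<lambda>i. adj ipH ipK (Q i) (P i (inv (mixed_op I P Q) f))) has_sum f) I"
proof -
  let ?S = "mixed_op I P Q"
  have bij: "bij ?S" and inv: "bounded_linear (inv ?S)"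
    using GL by (auto simp: GL_def bounded_op_def)
  show "((\<lambda>i. inv ?S (adj ipH ipK (Q i) (P i f))) has_sum f) I"
    using has_sum_bounded_linear[OF inv mixed_op_has_sum[OF P Q, of f]] bij
    by (simp add: bij_is_inj)
  show "((\<lambda>i. adj ipH ipK (Q i) (P i (inv ?S f))) has_sum f) I"
    using mixed_op_has_sum[OF P Q, of "inv ?S f"] bij
    by (simp add: bij_is_surj surj_f_inv_f)
qed

lemma controlled_g_bessel_absorb:
  assumes "controlled_g_bessel sH sK I V T L"
  shows "bessel_family I (\<lambda>i. L i \<circ> T)"
  using assms
  by (auto simp: controlled_g_bessel_def bessel_family_def g_bessel_bound_def
      intro!: bounded_op_comp GL_imp_bounded_op)

text \<open>The outer adjoint is absorbed as well, because \<open>U\<^sup>* (G i)\<^sup>* = (G i \<circ> U)\<^sup>*\<close>.\<close>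

lemma cross_op_eq_mixed_op:
  assumes "U \<in> GL sH" and "\<And>i. i \<in> I \<Longrightarrow> G i \<in> bounded_op sH sK (V i)"
  shows "cross_op ipH ipK I T G L U = mixed_op I (\<lambda>i. L i \<circ> T) (\<lambda>i. G i \<circ> U)"
  unfolding cross_op_def mixed_op_def fun_eq_iff
  using assms by (auto intro!: infsum_cong adj_comp GL_imp_bounded_op)

end

section \<open>Perturbation of the identity and of the frame operator\<close>

theorem mainTheorem4:
  fixes sH :: "'k::rc_field \<Rightarrow> 'h::banach \<Rightarrow> 'h" and ipH :: "'h \<Rightarrow> 'h \<Rightarrow> 'k"
    and sK :: "'k \<Rightarrow> 'g::banach \<Rightarrow> 'g" and ipK :: "'g \<Rightarrow> 'g \<Rightarrow> 'k"
    and I :: "int set" and V :: "int \<Rightarrow> 'g set"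
    and T U :: "'h \<Rightarrow> 'h" and \<Lambda> \<Gamma> :: "int \<Rightarrow> 'h \<Rightarrow> 'g"
  defines "S \<equiv> cross_op ipH ipK I T \<Gamma> \<Lambda> U"
    and "S' \<equiv> cross_op ipH ipK I U \<Lambda> \<Gamma> T"
  assumes "separable_hilbert_space sH ipH"
    and "separable_hilbert_space sK ipK"
    and "\<forall>i\<in>I. closed_subspace sK (V i)"
    and "T \<in> GL sH" and "U \<in> GL sH"
    and "controlled_g_bessel sH sK I V T \<Lambda>"
    and "controlled_g_bessel sH sK I V U \<Gamma>"
    and "(\<exists>A B lam. controlled_g_frame sH sK I V T \<Lambda> A B \<and> 0 \<le> lam \<and> lam < A \<and>
            (\<forall>f. norm (S f - (\<Sum>\<^sub>\<infinity>i\<in>I. adj ipH ipH T (adj ipH ipK (\<Lambda> i) (\<Lambda> i (T f)))))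
                   \<le> lam * norm f))
       \<or> (\<exists>\<epsilon>. 0 < \<epsilon> \<and> \<epsilon> < 1 \<and> (\<forall>f. norm (f - S f) \<le> \<epsilon> * norm f))"
  shows "S \<in> GL sH \<and> S' \<in> GL sH
    \<and> resolution_of_identity sH I
        (\<lambda>i f. inv S (adj ipH ipH U (adj ipH ipK (\<Gamma> i) (\<Lambda> i (T f)))))
    \<and> (\<forall>f. ((\<lambda>i. inv S (adj ipH ipH U (adj ipH ipK (\<Gamma> i) (\<Lambda> i (T f))))) has_sum f) I
         \<and> ((\<lambda>i. adj ipH ipH U (adj ipH ipK (\<Gamma> i) (\<Lambda> i (T (inv S f))))) has_sum f) I)
    \<and> (\<forall>f. ((\<lambda>i. inv S' (adj ipH ipH T (adj ipH ipK (\<Lambda> i) (\<Gamma> i (U f))))) has_sum f) I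
         \<and> ((\<lambda>i. adj ipH ipH T (adj ipH ipK (\<Lambda> i) (\<Gamma> i (U (inv S' f))))) has_sum f) I)"
proof -
  interpret hilbert_pair sH ipH sK ipK
    using assms(3,4) by (rule hilbert_pair.intro)
  define P where "P i = \<Lambda> i \<circ> T" for i
  define Q where "Q i = \<Gamma> i \<circ> U" for i
  have P: "bessel_family I P" and Q: "bessel_family I Q"
    using assms(8,9)[THEN controlled_g_bessel_absorb] by (simp_all add: P_def[abs_def] Q_def[abs_def])
  have \<Lambda>: "\<And>i. i \<in> I \<Longrightarrow> \<Lambda> i \<in> bounded_op sH sK (V i)"
    and \<Gamma>: "\<And>i. i \<in> I \<Longrightarrow> \<Gamma> i \<in> bounded_op sH sK (V i)"
    using assms(8,9) by (auto simp: controlled_g_bessel_def)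
  have adj_Q: "adj ipH ipH U (adj ipH ipK (\<Gamma> i) y) = adj ipH ipK (Q i) y" if "i \<in> I" for i y
    unfolding Q_def using adj_comp[OF GL_imp_bounded_op[OF assms(7)] \<Gamma>[OF that]] .
  have adj_P: "adj ipH ipH T (adj ipH ipK (\<Lambda> i) y) = adj ipH ipK (P i) y" if "i \<in> I" for i y
    unfolding P_def using adj_comp[OF GL_imp_bounded_op[OF assms(6)] \<Lambda>[OF that]] .
  have S: "S = mixed_op I P Q"
    unfolding S_def P_def[abs_def] Q_def[abs_def] using assms(7) \<Gamma> by (rule cross_op_eq_mixed_op)
  have S': "S' = mixed_op I Q P"
    unfolding S'_def P_def[abs_def] Q_def[abs_def] using assms(6) \<Lambda> by (rule cross_op_eq_mixed_op)
  have "\<exists>c>0. \<forall>f. c * (norm f)\<^sup>2 \<le> re (ipH (S f) f)"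
    using assms(10)
  proof (elim disjE exE conjE)
    fix A B lam
    assume frame: "controlled_g_frame sH sK I V T \<Lambda> A B" and "lam < A"
      and pert: "\<forall>f. norm (S f - (\<Sum>\<^sub>\<infinity>i\<in>I. adj ipH ipH T (adj ipH ipK (\<Lambda> i) (\<Lambda> i (T f)))))
        \<le> lam * norm f"
    have "(A - lam) * (norm f)\<^sup>2 \<le> re (ipH (S f) f)" for f
    proof -
      have "(\<Sum>\<^sub>\<infinity>i\<in>I. adj ipH ipH T (adj ipH ipK (\<Lambda> i) (\<Lambda> i (T f)))) = mixed_op I P P f"
        unfolding mixed_op_def by (rule infsum_cong) (simp add: adj_P, simp add: P_def)
      with pert have near: "norm (mixed_op I P P f - S f) \<le> lam * norm f"
        by (metis norm_minus_commute)
      have "A * (norm f)\<^sup>2 \<le> re (ipH (mixed_op I P P f) f)"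
        using frame by (simp add: re_ip_frame_op[OF P] controlled_g_frame_def P_def)
      also have "\<dots> = re (ipH (S f) f) + re (ipH (mixed_op I P P f - S f) f)"
        by (simp add: H.ip_diff_left re_diff)
      also have "re (ipH (mixed_op I P P f - S f) f) \<le> (lam * norm f) * norm f"
        using H.re_ip_le near by (meson mult_right_mono norm_ge_zero order_trans)
      finally show ?thesis by (simp add: power2_eq_square left_diff_distrib)
    qed
    with \<open>lam < A\<close> show ?thesis by (intro exI[of _ "A - lam"]) simp
  next
    fix \<epsilon> :: real assume "\<epsilon> < 1" and pert: "\<forall>f. norm (f - S f) \<le> \<epsilon> * norm f"
    have "(1 - \<epsilon>) * (norm f)\<^sup>2 \<le> re (ipH (S f) f)" for f
    proof -
      have "(norm f)\<^sup>2 = re (ipH (S f) f) + re (ipH (f - S f) f)"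
        by (simp add: H.ip_diff_left re_diff H.re_ip_self)
      also have "re (ipH (f - S f) f) \<le> (\<epsilon> * norm f) * norm f"
        using H.re_ip_le pert by (meson mult_right_mono norm_ge_zero order_trans)
      finally show ?thesis by (simp add: power2_eq_square left_diff_distrib)
    qed
    with \<open>\<epsilon> < 1\<close> show ?thesis by (intro exI[of _ "1 - \<epsilon>"]) simp
  qed
  then obtain c where c: "c > 0" "\<And>f. c * (norm f)\<^sup>2 \<le> re (ipH (S f) f)" by blast
  have GL: "mixed_op I P Q \<in> GL sH" "mixed_op I Q P \<in> GL sH"
    using H.coercive_imp_GL[OF mixed_op_bounded_op[OF P Q] c(1)]
      H.coercive_imp_GL[OF mixed_op_bounded_op[OF Q P] c(1)] c(2)
    by (simp_all add: S re_ip_mixed_op_swap[OF P Q])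
  have rec: "((\<lambda>i. inv S (adj ipH ipH U (adj ipH ipK (\<Gamma> i) (\<Lambda> i (T f))))) has_sum f) I"
    "((\<lambda>i. adj ipH ipH U (adj ipH ipK (\<Gamma> i) (\<Lambda> i (T (inv S f))))) has_sum f) I"
    "((\<lambda>i. inv S' (adj ipH ipH T (adj ipH ipK (\<Lambda> i) (\<Gamma> i (U f))))) has_sum f) I"
    "((\<lambda>i. adj ipH ipH T (adj ipH ipK (\<Lambda> i) (\<Gamma> i (U (inv S' f))))) has_sum f) I" for f
    using mixed_op_reconstruction[OF P Q GL(1), of f] mixed_op_reconstruction[OF Q P GL(2), of f]
    by (simp_all add: S S' adj_P adj_Q P_def Q_def cong: has_sum_cong)
  have "(\<lambda>f. inv S (adj ipH ipH U (adj ipH ipK (\<Gamma> i) (\<Lambda> i (T f))))) \<in> bounded_op sH sH UNIV"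
    if "i \<in> I" for i
  proof -
    have "inv S \<circ> (adj ipH ipK (Q i) \<circ> P i) \<in> bounded_op sH sH UNIV"
      using GL(1) bessel_family_bounded_op[OF P that]
        adj_bounded_op[OF bessel_family_bounded_op[OF Q that]]
      by (auto simp: S GL_def intro!: bounded_op_comp)
    then show ?thesis by (simp add: o_def adj_Q[OF that] P_def)
  qed
  then show ?thesis
    using GL rec by (simp add: S S' resolution_of_identity_def)
qed

end
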